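(* Let $\mathcal{A}$ be a complex Banach algebra with identity $1$ and let $a\in\mathcal{A}$. Then $a\in\mathcal{A}^{ad}$ (i.e. $a$ is ag-Drazin invertible) if and only if $0\notin\mathrm{acc}\,\sigma_d(a)$.
   Context: For a complex Banach algebra $\mathcal{A}$ with identity $1$ and $a\in\mathcal{A}$: $\sigma(a)$ is the spectrum of $a$; $\{a\}'=\{b\in\mathcal{A}: ab=ba\}$; $\mathcal{A}^{qnil}=\{a\in\mathcal{A}:\sigma(a)=\{0\}\}$. An element $a$ is generalized Drazin invertible if there exists $x\in\{a\}'$ with $xax=x$ and $a-a^2x\in\mathcal{A}^{qnil}$; $\mathcal{A}^{d}$ is the set of all such elements. The generalized Drazin spectrum of $a$ is $\sigma_d(a)=\{\lambda\in\mathbb{C}: a-\lambda 1\notin\mathcal{A}^{d}\}$ (it may be empty). Define $\mathcal{A}^{acc}=\{a\in\mathcal{A}: a-\lambda 1\in\mathcal{A}^{d}\text{ for all }\lambda\in\mathbb{C}\setminus\{0\}\}$. An element $a$ is ag-Drazin invertible if there exists $x\in\{a\}'$ with $xax=x$ and $a-a^2x\in\mathcal{A}^{acc}$; $\mathcal{A}^{ad}$ is the set of all such elements. For $M\subseteq\mathbb{C}$, $\mathrm{acc}\,M$ denotes the set of accumulation points of $M$. *)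

theory Defs
  imports "HOL-Analysis.Analysis"
begin

text \<open>
  Complex Banach algebras with identity. Completeness, submultiplicativity of the norm and
  \<open>0 \<noteq> 1\<close> come from the parent classes; the normalization \<open>norm 1 = 1\<close> is not imposed.
  The complex scalar multiplication extends the real one.
\<close>

class complex_banach_algebra_1 = real_normed_algebra + real_algebra_1 + banach +
  fixes scaleC :: "complex \<Rightarrow> 'a \<Rightarrow> 'a" (infixr "*\<^sub>C" 75)
  assumes scaleC_add_right: "c *\<^sub>C (x + y) = c *\<^sub>C x + c *\<^sub>C y"
    and scaleC_add_left: "(c + d) *\<^sub>C x = c *\<^sub>C x + d *\<^sub>C x"
    and scaleC_scaleC: "c *\<^sub>C d *\<^sub>C x = (c * d) *\<^sub>C x"
    and scaleC_of_real: "complex_of_real r *\<^sub>C x = r *\<^sub>R x"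
    and mult_scaleC_left: "(c *\<^sub>C x) * y = c *\<^sub>C (x * y)"
    and mult_scaleC_right: "x * (c *\<^sub>C y) = c *\<^sub>C (x * y)"
    and norm_scaleC: "norm (c *\<^sub>C x) = cmod c * norm x"

instantiation complex :: complex_banach_algebra_1
begin

definition scaleC_complex :: "complex \<Rightarrow> complex \<Rightarrow> complex"
  where "scaleC_complex c x = c * x"

instance
  by standard
    (simp_all add: scaleC_complex_def algebra_simps norm_mult scaleR_conv_of_real)

end

definition invertible_elem :: "'a::complex_banach_algebra_1 \<Rightarrow> bool"
  where "invertible_elem a \<longleftrightarrow> (\<exists>b. a * b = 1 \<and> b * a = 1)"

definition spectrum :: "'a::complex_banach_algebra_1 \<Rightarrow> complex set"
  where "spectrum a = {\<mu>. \<not> invertible_elem (a - \<mu> *\<^sub>C 1)}"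

definition commutant :: "'a::complex_banach_algebra_1 \<Rightarrow> 'a set"
  where "commutant a = {b. a * b = b * a}"

definition qnil :: "'a::complex_banach_algebra_1 set"
  where "qnil = {a. spectrum a = {0}}"

definition gd_invertible :: "'a::complex_banach_algebra_1 set"
  where "gd_invertible = {a. \<exists>x \<in> commutant a. x * a * x = x \<and> a - a\<^sup>2 * x \<in> qnil}"

definition gd_spectrum :: "'a::complex_banach_algebra_1 \<Rightarrow> complex set"
  where "gd_spectrum a = {\<mu>. a - \<mu> *\<^sub>C 1 \<notin> gd_invertible}"

definition acc_elems :: "'a::complex_banach_algebra_1 set"
  where "acc_elems = {a. \<forall>\<mu>. \<mu> \<noteq> 0 \<longrightarrow> a - \<mu> *\<^sub>C 1 \<in> gd_invertible}"

definition agd_invertible :: "'a::complex_banach_algebra_1 set"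
  where "agd_invertible = {a. \<exists>x \<in> commutant a. x * a * x = x \<and> a - a\<^sup>2 * x \<in> acc_elems}"

end

theory Submission
  imports Defs
begin

text \<open>
  Everything is reduced to the position of \<open>0\<close> relative to spectra. An outer inverse \<open>x\<close> of \<open>a\<close>
  that commutes with \<open>a\<close> gives an idempotent \<open>p = 1 - a * x\<close>, and \<open>a\<close> splits into \<open>a * p\<close>, which is
  the residual \<open>a - a\<^sup>2 * x\<close>, and a part with inverse \<open>x\<close> in the complementary corner. The second part
  contributes no spectrum near \<open>0\<close>, so \<open>a\<close> and its residual have the same spectrum in a
  punctured neighbourhood of \<open>0\<close>; globally, the residual acquires no spectrum beyond that of \<open>a\<close> and
  the point \<open>0\<close> (\<open>spectrum_subset_residual\<close>, \<open>spectrum_residual_subset\<close>).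

  Conversely, every circle around \<open>0\<close> that misses the spectrum of \<open>a\<close> gives rise to such an \<open>x\<close>, with the
  spectrum of the residual confined to its interior (\<open>circle_splitting\<close>). The idempotent needed is the Riesz
  idempotent, which is usually a contour integral of the resolvent. Here it is obtained as the limit
  of \<open>(1 - b ^ n)\<^sup>-\<^sup>1\<close> for \<open>n = 2 ^ k\<close>, with the circle scaled to radius one: this inverse is the
  mean of \<open>(1 - \<omega> b)\<^sup>-\<^sup>1\<close> over the \<open>n\<close>-th roots of unity \<open>\<omega>\<close>, hence a Riemann sum of that integral. Convergence and
  idempotency both follow from one step: with \<open>u\<close>, \<open>v\<close> the inverses of \<open>1 - X\<close> and \<open>1 + X\<close>, the
  inverse of \<open>1 - X\<^sup>2\<close> is at once the mean and the product of \<open>u\<close> and \<open>v\<close>, while squaring \<open>b\<close>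
  contracts the Lipschitz constant of the resolvent on the circle, which forces \<open>u - v\<close> to \<open>0\<close>.

  Small circles give Koliha's theorem that \<open>a\<close> is generalized Drazin invertible iff \<open>0\<close> is not an
  accumulation point of its spectrum, so the generalized Drazin spectrum is the set of accumulation
  points of the spectrum (\<open>gd_spectrum_eq\<close>). For the theorem itself, a residual in \<open>acc_elems\<close>
  has no nonzero accumulation point in its spectrum, and then \<open>a\<close> has none near \<open>0\<close>. In
  the other direction, if \<open>0\<close> is not an accumulation point of accumulation points, the
  spectrum is finite on thin annuli around \<open>0\<close>; some circle avoids it, and the splitting along this
  circle has a residual whose spectrum accumulates at most at \<open>0\<close>.
\<close>

section \<open>Complex scalars and invertibility\<close>

lemma scaleC_one [simp]: "1 *\<^sub>C x = x"
  using scaleC_of_real[of 1 x] by simp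

lemma scaleC_zero_left [simp]: "0 *\<^sub>C x = 0"
  using scaleC_of_real[of 0 x] by simp

lemma scaleC_minus_left: "(- c) *\<^sub>C x = - (c *\<^sub>C x)"
  using scaleC_add_left[of c "- c" x] by (simp add: eq_neg_iff_add_eq_0 add.commute)

lemma scaleC_diff_left: "(c - d) *\<^sub>C x = c *\<^sub>C x - d *\<^sub>C x"
  using scaleC_add_left[of c "- d" x] by (simp add: scaleC_minus_left)

lemma scaleC_zero_right [simp]: "c *\<^sub>C 0 = 0"
  using scaleC_add_right[of c 0 0] by simp

lemma scaleC_minus_right: "c *\<^sub>C (- x) = - (c *\<^sub>C x)"
  using scaleC_add_right[of c x "- x"] by (simp add: eq_neg_iff_add_eq_0 add.commute)

lemma scaleC_diff_right: "c *\<^sub>C (x - y) = c *\<^sub>C x - c *\<^sub>C y"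
  using scaleC_add_right[of c x "- y"] by (simp add: scaleC_minus_right)

lemma scaleC_power: "(c *\<^sub>C x) ^ n = c ^ n *\<^sub>C x ^ n"
  by (induction n) (simp_all add: mult_scaleC_left mult_scaleC_right scaleC_scaleC mult.commute)

lemma invertible_elem_of_left_right:
  assumes "a * b = 1" "c * a = 1"
  shows "invertible_elem a"
proof -
  have "c = b" using assms by (metis mult.assoc mult_1_left mult_1_right)
  then show ?thesis using assms by (auto simp: invertible_elem_def)
qed

lemma invertible_elem_scaleC:
  assumes "c \<noteq> 0" "invertible_elem a"
  shows "invertible_elem (c *\<^sub>C a)"
proof -
  obtain b where "a * b = 1" "b * a = 1" using assms by (auto simp: invertible_elem_def)
  then have "(c *\<^sub>C a) * (inverse c *\<^sub>C b) = 1 \<and> (inverse c *\<^sub>C b) * (c *\<^sub>C a) = 1"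
    using assms(1) by (simp add: mult_scaleC_left mult_scaleC_right scaleC_scaleC)
  then show ?thesis unfolding invertible_elem_def by blast
qed

text \<open>Passes to the form \<open>1 - z b\<close>, on which the Neumann series and the squaring argument operate.\<close>

lemma notin_spectrum_iff:
  assumes "\<mu> \<noteq> 0"
  shows "\<mu> \<notin> spectrum a \<longleftrightarrow> invertible_elem (1 - inverse \<mu> *\<^sub>C a)"
proof -
  have 1: "1 - inverse \<mu> *\<^sub>C a = (- inverse \<mu>) *\<^sub>C (a - \<mu> *\<^sub>C 1)"
    using assms by (simp add: scaleC_diff_right scaleC_scaleC scaleC_minus_left)
  have 2: "a - \<mu> *\<^sub>C 1 = (- \<mu>) *\<^sub>C (1 - inverse \<mu> *\<^sub>C a)"
    using assms by (simp add: scaleC_diff_right scaleC_scaleC scaleC_minus_left)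
  show ?thesis
    unfolding spectrum_def using assms invertible_elem_scaleC 1 2
    by (metis (no_types, lifting) inverse_zero_imp_zero mem_Collect_eq neg_equal_0_iff_equal)
qed

lemma spectrum_shift: "spectrum (a - \<nu> *\<^sub>C 1) = (\<lambda>\<mu>. \<mu> - \<nu>) ` spectrum a"
proof -
  have "\<mu> \<in> spectrum (a - \<nu> *\<^sub>C 1) \<longleftrightarrow> \<mu> + \<nu> \<in> spectrum a" for \<mu>
    by (simp add: spectrum_def scaleC_add_left algebra_simps)
  then show ?thesis by (force simp: image_iff algebra_simps)
qed

lemma commutant_diff: "\<lbrakk>x \<in> commutant b; y \<in> commutant b\<rbrakk> \<Longrightarrow> x - y \<in> commutant b"
  by (simp add: commutant_def algebra_simps)

lemma commutant_mult: "\<lbrakk>x \<in> commutant b; y \<in> commutant b\<rbrakk> \<Longrightarrow> x * y \<in> commutant b"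
  by (simp add: commutant_def mult.assoc[symmetric]) (simp add: mult.assoc)

lemma commutant_one: "1 \<in> commutant b"
  by (simp add: commutant_def)

lemma commutant_power: "b ^ n \<in> commutant b"
  by (simp add: commutant_def power_commutes)

text \<open>
  Membership in \<open>commutant b\<close> is symmetric in the two elements, so this also serves to move an
  inverse past an element that commutes with the original.
\<close>

lemma commutant_inverse:
  assumes "x \<in> commutant b" "x * y = 1" "y * x = 1"
  shows "y \<in> commutant b"
proof -
  have "b * y = y * x * b * y" using assms by simp
  also have "\<dots> = y * (x * b) * y" by (simp add: mult.assoc)
  also have "\<dots> = y * (b * x) * y" using assms by (simp add: commutant_def)
  also have "\<dots> = y * b" using assms by (simp add: mult.assoc)
  finally show ?thesis by (simp add: commutant_def)
qed

definition elem_inverse :: "'a::complex_banach_algebra_1 \<Rightarrow> 'a"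
  where "elem_inverse a = (SOME b. a * b = 1 \<and> b * a = 1)"

lemma elem_inverse:
  assumes "invertible_elem a"
  shows "a * elem_inverse a = 1" "elem_inverse a * a = 1"
  using someI_ex[of "\<lambda>b. a * b = 1 \<and> b * a = 1"] assms
  by (auto simp: invertible_elem_def elem_inverse_def)

lemma elem_inverse_unique:
  assumes "a * b = 1" "b * a = 1"
  shows "elem_inverse a = b"
proof -
  have "invertible_elem a" using assms by (auto simp: invertible_elem_def)
  from elem_inverse[OF this] assms show ?thesis
    by (metis mult.assoc mult_1_left mult_1_right)
qed

lemma norm_power_Suc_le:
  fixes x :: "'a::complex_banach_algebra_1"
  shows "norm (x ^ Suc n) \<le> norm x ^ Suc n"
proof (induction n)
  case (Suc n)
  have "norm (x ^ Suc (Suc n)) \<le> norm x * norm (x ^ Suc n)"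
    by (metis norm_mult_ineq power_Suc)
  also have "\<dots> \<le> norm x * norm x ^ Suc n"
    using Suc.IH by (intro mult_left_mono) auto
  finally show ?case by simp
qed simp

text \<open>
  The Neumann series. Since \<open>norm 1\<close> may exceed \<open>1\<close>, it is compared with the geometric series only
  from the first power on.
\<close>

lemma invertible_elem_one_minus:
  fixes x :: "'a::complex_banach_algebra_1"
  assumes "norm x < 1"
  shows "invertible_elem (1 - x)"
proof -
  have "summable (\<lambda>n. norm x ^ Suc n)"
    using assms by (subst summable_Suc_iff) (simp add: summable_geometric)
  then have "summable (\<lambda>n. x ^ Suc n)"
    by (rule summable_comparison_test'[where N = 0]) (rule norm_power_Suc_le)
  then have s: "summable (\<lambda>n. x ^ n)" by (subst (asm) summable_Suc_iff)
  define S where "S = (\<Sum>n. x ^ n)"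
  have tail: "(\<Sum>n. x ^ Suc n) = S - 1"
    unfolding S_def using suminf_split_head[OF s] by simp
  have "x * S = (\<Sum>n. x * x ^ n)" unfolding S_def by (rule suminf_mult[OF s, symmetric])
  then have l: "x * S = S - 1" using tail by simp
  have "S * x = (\<Sum>n. x ^ n * x)" unfolding S_def by (rule suminf_mult2[OF s])
  then have r: "S * x = S - 1" using tail by (simp add: power_commutes)
  have "(1 - x) * S = 1 \<and> S * (1 - x) = 1" using l r by (simp add: algebra_simps)
  then show ?thesis by (auto simp: invertible_elem_def)
qed

text \<open>
  Repeated use of \<open>1 - Y\<^sup>2 = (1 - Y) (1 + Y)\<close>; it shows that a spectral radius below one can be
  detected on a single power.
\<close>

lemma invertible_elem_one_minus_of_power:
  assumes "invertible_elem (1 - y ^ (2 ^ k))"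
  shows "invertible_elem (1 - y)"
  using assms
proof (induction k)
  case (Suc k)
  define Y where "Y = y ^ (2 ^ k)"
  have "y ^ (2 ^ Suc k) = Y * Y"
    by (simp add: Y_def mult_2 power_add)
  then have e: "1 - y ^ (2 ^ Suc k) = (1 - Y) * (1 + Y)" "1 - y ^ (2 ^ Suc k) = (1 + Y) * (1 - Y)"
    by (simp_all add: algebra_simps)
  obtain R where R: "(1 - y ^ (2 ^ Suc k)) * R = 1" "R * (1 - y ^ (2 ^ Suc k)) = 1"
    using Suc.prems by (auto simp: invertible_elem_def)
  have "(1 - Y) * ((1 + Y) * R) = 1" using R(1) e(1) by (simp add: mult.assoc)
  moreover have "(R * (1 + Y)) * (1 - Y) = 1" using R(2) e(2) by (simp add: mult.assoc)
  ultimately have "invertible_elem (1 - Y)" by (rule invertible_elem_of_left_right)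
  then show ?case using Suc.IH by (simp add: Y_def)
qed simp

section \<open>Outer inverses and the spectrum\<close>

lemma invertible_elem_glue:
  assumes "a * u = p" "u * a = p" "a * v = 1 - p" "v * a = 1 - p"
  shows "invertible_elem a"
proof -
  have "a * (u + v) = 1 \<and> (u + v) * a = 1" using assms by (simp add: algebra_simps)
  then show ?thesis by (auto simp: invertible_elem_def)
qed

text \<open>
  If \<open>c\<close> and \<open>d\<close> agree on the corner cut out by \<open>p\<close>, an inverse of one of them inverts the other
  there. It is applied to \<open>a - \<mu>\<close> and \<open>a * p - \<mu>\<close>, in both orders.
\<close>

lemma corner_inverse:
  fixes c :: "'a::complex_banach_algebra_1"
  assumes c: "p * c = c * p" "p * d = c * p" "d * p = c * p" and r: "c * r = 1" "r * c = 1"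
  shows "d * (p * r) = p" "(p * r) * d = p"
proof -
  have pr: "p * r = r * p"
    using commutant_inverse[of c p r] c(1) r by (simp add: commutant_def)
  have "d * (p * r) = (p * c) * r" using c by (simp add: mult.assoc[symmetric])
  then show "d * (p * r) = p" using r(1) by (simp add: mult.assoc)
  have "(p * r) * d = r * (c * p)" using c(2) pr by (simp add: mult.assoc)
  then show "(p * r) * d = p" using r(2) by (simp add: mult.assoc[symmetric])
qed

locale commuting_outer_inverse =
  fixes a x :: "'a::complex_banach_algebra_1"
  assumes comm: "x \<in> commutant a" and outer: "x * a * x = x"
begin

definition p where "p = 1 - a * x"

lemma ax_commute: "a * x = x * a" using comm by (simp add: commutant_def)

lemma residual: "a - a\<^sup>2 * x = a * p"
  by (simp add: p_def algebra_simps power2_eq_square)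

lemma p_idem: "p * p = p"
proof -
  have "a * x * (a * x) = a * x" by (metis mult.assoc outer)
  then show ?thesis by (simp add: p_def algebra_simps)
qed

lemma pa_commute: "p * a = a * p"
  by (simp add: p_def algebra_simps) (metis ax_commute mult.assoc)

lemma residual_shift_mult_p: "(a * p - \<mu> *\<^sub>C 1) * p = (a - \<mu> *\<^sub>C 1) * p"
  by (simp add: algebra_simps mult_scaleC_left p_idem)

lemma p_mult_shift: "p * (a - \<mu> *\<^sub>C 1) = (a - \<mu> *\<^sub>C 1) * p"
  by (simp add: algebra_simps mult_scaleC_left mult_scaleC_right pa_commute)

lemma p_mult_residual_shift: "p * (a * p - \<mu> *\<^sub>C 1) = (a - \<mu> *\<^sub>C 1) * p"
proof -
  have "p * (a * p) = a * p" by (metis p_idem pa_commute mult.assoc)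
  then show ?thesis by (simp add: algebra_simps mult_scaleC_left mult_scaleC_right)
qed

text \<open>
  For \<open>\<mu> \<noteq> 0\<close>, \<open>a * p - \<mu>\<close> agrees with \<open>a - \<mu>\<close> on the corner of \<open>p\<close> and with the scalar
  \<open>- \<mu>\<close> on the corner of \<open>1 - p\<close>.
\<close>

lemma spectrum_residual_subset: "spectrum (a - a\<^sup>2 * x) \<subseteq> insert 0 (spectrum a)"
proof
  fix \<mu> assume \<mu>: "\<mu> \<in> spectrum (a - a\<^sup>2 * x)"
  show "\<mu> \<in> insert 0 (spectrum a)"
  proof (rule ccontr)
    assume "\<mu> \<notin> insert 0 (spectrum a)"
    then have "\<mu> \<noteq> 0" and "invertible_elem (a - \<mu> *\<^sub>C 1)" by (auto simp: spectrum_def)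
    then obtain r where r: "(a - \<mu> *\<^sub>C 1) * r = 1" "r * (a - \<mu> *\<^sub>C 1) = 1"
      by (auto simp: invertible_elem_def)
    let ?c = "a * p - \<mu> *\<^sub>C 1" and ?v = "(- inverse \<mu>) *\<^sub>C (1 - p)"
    have 1: "?c * (p * r) = p" "(p * r) * ?c = p"
      using corner_inverse[OF p_mult_shift p_mult_residual_shift residual_shift_mult_p r] by auto
    have "a * p * (1 - p) = 0" "(1 - p) * (a * p) = 0"
      by (simp_all add: right_diff_distrib left_diff_distrib mult.assoc p_idem)
         (metis mult.assoc p_idem pa_commute)
    then have 3: "?c * ?v = 1 - p" "?v * ?c = 1 - p"
      using \<open>\<mu> \<noteq> 0\<close>
      by (simp_all add: left_diff_distrib right_diff_distrib mult_scaleC_left mult_scaleC_right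
        scaleC_scaleC scaleC_diff_right scaleC_minus_left)
    have "invertible_elem ?c"
      using 1 3 by (rule invertible_elem_glue)
    then show False using \<mu> residual by (simp add: spectrum_def)
  qed
qed

text \<open>
  On the corner of \<open>1 - p = a * x\<close> the element \<open>a - \<mu>\<close> equals \<open>a (1 - \<mu> x)\<close>, so \<open>(1 - \<mu> x)\<^sup>-\<^sup>1 x\<close>
  inverts it there as soon as \<open>\<mu> x\<close> has norm below one; on the corner of \<open>p\<close> the inverse of the
  shifted residual does the job.
\<close>

lemma spectrum_subset_residual:
  obtains \<delta> where "\<delta> > 0" "spectrum a \<inter> ball 0 \<delta> \<subseteq> spectrum (a - a\<^sup>2 * x)"
proof
  define \<delta> where "\<delta> = 1 / (norm x + 1)"
  show "\<delta> > 0" by (simp add: \<delta>_def add_nonneg_pos)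
  show "spectrum a \<inter> ball 0 \<delta> \<subseteq> spectrum (a - a\<^sup>2 * x)"
  proof
    fix \<mu> assume \<mu>: "\<mu> \<in> spectrum a \<inter> ball 0 \<delta>"
    show "\<mu> \<in> spectrum (a - a\<^sup>2 * x)"
    proof (rule ccontr)
      assume "\<mu> \<notin> spectrum (a - a\<^sup>2 * x)"
      then obtain r where r: "(a * p - \<mu> *\<^sub>C 1) * r = 1" "r * (a * p - \<mu> *\<^sub>C 1) = 1"
        by (auto simp: spectrum_def invertible_elem_def residual)
      let ?c = "a - \<mu> *\<^sub>C 1"
      have 1: "?c * (p * r) = p" "(p * r) * ?c = p"
        by (rule corner_inverse[OF _ _ _ r]; simp add: residual_shift_mult_p p_mult_shift p_mult_residual_shift)+
      have "cmod \<mu> * (norm x + 1) < 1" using \<mu>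
        by (simp add: \<delta>_def pos_less_divide_eq add_nonneg_pos)
      then have "norm (\<mu> *\<^sub>C x) < 1"
        using norm_ge_zero[of \<mu>] unfolding norm_scaleC distrib_left by linarith
      then obtain w where w: "(1 - \<mu> *\<^sub>C x) * w = 1" "w * (1 - \<mu> *\<^sub>C x) = 1"
        using invertible_elem_one_minus by (auto simp: invertible_elem_def)
      have "x * (a * x) = x" using outer by (simp add: mult.assoc)
      then have xc: "x * ?c = (1 - \<mu> *\<^sub>C x) * (a * x)" "?c * x = (1 - \<mu> *\<^sub>C x) * (a * x)"
        by (simp_all add: left_diff_distrib right_diff_distrib mult_scaleC_left mult_scaleC_right ax_commute[symmetric])
      have "?c * (1 - \<mu> *\<^sub>C x) = (1 - \<mu> *\<^sub>C x) * ?c"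
        by (simp add: left_diff_distrib right_diff_distrib mult_scaleC_left mult_scaleC_right
          scaleC_diff_right ax_commute[symmetric])
      then have cw: "?c * w = w * ?c"
        using commutant_inverse[OF _ w, of ?c] by (simp add: commutant_def)
      have "?c * (w * x) = w * (?c * x)" using cw by (simp add: mult.assoc[symmetric])
      also have "\<dots> = 1 - p" unfolding xc using w(2) by (simp add: p_def mult.assoc[symmetric])
      finally have 2: "?c * (w * x) = 1 - p" .
      have "(w * x) * ?c = w * (x * ?c)" by (simp add: mult.assoc)
      also have "\<dots> = 1 - p" unfolding xc using w(2) by (simp add: p_def mult.assoc[symmetric])
      finally have 3: "(w * x) * ?c = 1 - p" .
      have "invertible_elem ?c" using 1 2 3 by (rule invertible_elem_glue)
      then show False using \<mu> by (simp add: spectrum_def)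
    qed
  qed
qed

end

section \<open>Spectral splitting along a circle\<close>

text \<open>
  Invertibility along the whole circle and the Lipschitz bound are kept in one predicate because the
  squaring step needs the former to propagate the latter, and both must be passed on to the square.
\<close>

definition lipschitz_resolvent :: "real \<Rightarrow> 'a::complex_banach_algebra_1 \<Rightarrow> bool"
  where "lipschitz_resolvent L b \<longleftrightarrow>
    (\<forall>z. cmod z = 1 \<longrightarrow> invertible_elem (1 - z *\<^sub>C b)) \<and>
    (\<forall>z w. cmod z = 1 \<longrightarrow> cmod w = 1 \<longrightarrow>
      norm (elem_inverse (1 - z *\<^sub>C b) - elem_inverse (1 - w *\<^sub>C b)) \<le> L * cmod (z - w))"

lemma resolvent_identity:
  assumes "invertible_elem (1 - z *\<^sub>C b)" "invertible_elem (1 - w *\<^sub>C b)"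
  shows "elem_inverse (1 - z *\<^sub>C b) - elem_inverse (1 - w *\<^sub>C b) =
    elem_inverse (1 - z *\<^sub>C b) * ((z - w) *\<^sub>C b) * elem_inverse (1 - w *\<^sub>C b)"
proof -
  let ?R = "elem_inverse (1 - z *\<^sub>C b)" and ?Q = "elem_inverse (1 - w *\<^sub>C b)"
  have e: "(z - w) *\<^sub>C b = (1 - w *\<^sub>C b) - (1 - z *\<^sub>C b)" by (simp add: scaleC_diff_left)
  have "?R * ((z - w) *\<^sub>C b) * ?Q = ?R * ((1 - w *\<^sub>C b) * ?Q) - (?R * (1 - z *\<^sub>C b)) * ?Q"
    unfolding e by (simp only: left_diff_distrib right_diff_distrib mult.assoc)
  then show ?thesis using elem_inverse[OF assms(1)] elem_inverse[OF assms(2)] by simp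
qed

lemma norm_mult3_le:
  fixes x y z :: "'a::complex_banach_algebra_1"
  shows "norm (x * y * z) \<le> norm x * norm y * norm z"
  by (meson mult_right_mono norm_ge_zero norm_mult_ineq order_trans)

text \<open>
  By the resolvent identity the Lipschitz bound follows from boundedness on the circle, and
  boundedness follows from continuity by compactness.
\<close>

lemma lipschitz_resolventI:
  fixes b :: "'a::complex_banach_algebra_1"
  assumes inv: "\<And>z. cmod z = 1 \<Longrightarrow> invertible_elem (1 - z *\<^sub>C b)"
  obtains L where "L \<ge> 0" "lipschitz_resolvent L b"
proof -
  define R where "R z = elem_inverse (1 - z *\<^sub>C b)" for z
  let ?S = "sphere (0::complex) 1"
  have ident: "norm (R z - R w) \<le> norm (R z) * norm (R w) * norm b * cmod (z - w)"
    if "z \<in> ?S" "w \<in> ?S" for z w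
  proof -
    have "R z - R w = R z * ((z - w) *\<^sub>C b) * R w"
      unfolding R_def using that by (intro resolvent_identity inv) auto
    then have "norm (R z - R w) \<le> norm (R z) * norm ((z - w) *\<^sub>C b) * norm (R w)"
      using norm_mult3_le by metis
    then show ?thesis by (simp add: norm_scaleC mult_ac)
  qed
  have "continuous_on ?S R"
    unfolding continuous_on_def
  proof
    fix w assume w: "w \<in> ?S"
    let ?K = "norm (R w) * norm b"
    let ?F = "at w within ?S"
    have lim: "((\<lambda>z. ?K * cmod (z - w)) \<longlongrightarrow> 0) ?F"
      by (rule tendsto_eq_intros | simp)+
    then have "eventually (\<lambda>z. ?K * cmod (z - w) < 1 / 2) ?F"
      by (rule order_tendstoD) simp
    moreover have "eventually (\<lambda>z. z \<in> ?S) ?F"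
      by (simp add: eventually_at_filter)
    ultimately have "eventually (\<lambda>z. norm (R z - R w) \<le> 2 * norm (R w) * (?K * cmod (z - w))) ?F"
    proof eventually_elim
      case (elim z)
      \<comment> \<open>The factor \<open>norm (R z)\<close> in the resolvent identity is not yet controlled; close to \<open>w\<close>,
        half of it can be absorbed, which bounds it by \<open>2 * norm (R w)\<close>.\<close>
      have "norm (R z - R w) \<le> norm (R z) * (?K * cmod (z - w))"
        using ident[OF elim(2) w] by (simp add: mult_ac)
      also have "\<dots> \<le> norm (R z) * (1 / 2)"
        using elim(1) by (intro mult_left_mono) auto
      finally have "norm (R z) \<le> 2 * norm (R w)"
        using norm_triangle_ineq2[of "R z" "R w"] by simp
      then have "norm (R z) * (?K * cmod (z - w)) \<le> 2 * norm (R w) * (?K * cmod (z - w))"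
        by (intro mult_right_mono) auto
      then show ?case
        using \<open>norm (R z - R w) \<le> norm (R z) * (?K * cmod (z - w))\<close> by linarith
    qed
    moreover have "((\<lambda>z. 2 * norm (R w) * (?K * cmod (z - w))) \<longlongrightarrow> 0) ?F"
      using tendsto_mult_right_zero[OF lim] by simp
    ultimately have "((\<lambda>z. R z - R w) \<longlongrightarrow> 0) ?F"
      by (rule Lim_null_comparison)
    then show "(R \<longlongrightarrow> R w) ?F" by (simp add: LIM_zero_iff)
  qed
  then have "bounded (R ` ?S)"
    by (intro compact_imp_bounded compact_continuous_image) auto
  then obtain M where M: "\<forall>z\<in>?S. norm (R z) \<le> M" "M > 0"
    by (auto simp: bounded_pos)
  have "norm (R z - R w) \<le> (M * M * norm b) * cmod (z - w)" if "z \<in> ?S" "w \<in> ?S" for z w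
    using ident[OF that] M that
    by (smt (verit) mult_mono mult_right_mono norm_ge_zero mult_nonneg_nonneg)
  then have "lipschitz_resolvent (M * M * norm b) b"
    using inv unfolding lipschitz_resolvent_def R_def by simp
  then show thesis using that[of "M * M * norm b"] M(2) by simp
qed

text \<open>
  The partial fractions \<open>2 / (1 - X\<^sup>2) = 1 / (1 - X) + 1 / (1 + X)\<close>. The mean makes successive
  inverses close to each other, the product makes their limit idempotent.
\<close>

lemma elem_inverse_product_mean:
  fixes X :: "'a::complex_banach_algebra_1"
  assumes "invertible_elem (1 - X)" "invertible_elem (1 + X)"
  shows "invertible_elem (1 - X * X)"
    and "elem_inverse (1 - X * X) = elem_inverse (1 - X) * elem_inverse (1 + X)"
    and "elem_inverse (1 - X * X) = (1/2) *\<^sub>R (elem_inverse (1 - X) + elem_inverse (1 + X))"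
proof -
  let ?R = "elem_inverse (1 - X)" and ?Q = "elem_inverse (1 + X)"
  note R = elem_inverse[OF assms(1)] and Q = elem_inverse[OF assms(2)]
  have f: "1 - X * X = (1 + X) * (1 - X)" "1 - X * X = (1 - X) * (1 + X)"
    by (simp_all add: algebra_simps)
  have 1: "(1 - X * X) * (?R * ?Q) = 1"
    unfolding f(1) using R Q by (metis mult.assoc mult_1_left)
  have 2: "(?R * ?Q) * (1 - X * X) = 1"
    unfolding f(1) using R Q by (metis mult.assoc mult_1_left)
  show "invertible_elem (1 - X * X)" using 1 2 by (auto simp: invertible_elem_def)
  show prod: "elem_inverse (1 - X * X) = ?R * ?Q" using 1 2 by (rule elem_inverse_unique)
  have "?R + ?Q = ?R * ((1 + X) * ?Q) + (?R * (1 - X)) * ?Q" using R Q by simp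
  also have "\<dots> = ?R * ((1 + X) + (1 - X)) * ?Q"
    by (simp only: distrib_left distrib_right mult.assoc)
  also have "(1 + X) + (1 - X) = 1 + 1" by simp
  also have "?R * (1 + 1) * ?Q = 2 *\<^sub>R (?R * ?Q)"
    by (simp only: scaleR_2 distrib_left distrib_right mult_1_right)
  finally show "elem_inverse (1 - X * X) = (1/2) *\<^sub>R (?R + ?Q)" using prod by simp
qed

text \<open>
  Since \<open>z - w = (\<zeta> - \<omega>) (\<zeta> + \<omega>)\<close> and the squared moduli of the two factors add up to \<open>4\<close>, one factor
  is at least \<open>4/3\<close> in modulus (twice \<open>16/9\<close> is below \<open>4\<close>). Flipping the sign of \<open>\<omega>\<close> makes
  it the second factor.
\<close>

lemma unit_circle_root_distance:
  assumes "cmod z = 1" "cmod w = 1"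
  obtains \<zeta> \<omega> where "cmod \<zeta> = 1" "cmod \<omega> = 1" "\<zeta>\<^sup>2 = z" "\<omega>\<^sup>2 = w"
    "cmod (\<zeta> - \<omega>) \<le> 3/4 * cmod (z - w)"
proof -
  define \<zeta> where "\<zeta> = csqrt z"
  define \<omega> where "\<omega> = csqrt w"
  have sq: "\<zeta>\<^sup>2 = z" "\<omega>\<^sup>2 = w" by (simp_all add: \<zeta>_def \<omega>_def)
  have n: "cmod \<zeta> = 1" "cmod \<omega> = 1"
    using assms by (simp_all add: \<zeta>_def \<omega>_def norm_csqrt)
  have "(cmod (\<zeta> - \<omega>))\<^sup>2 + (cmod (\<zeta> + \<omega>))\<^sup>2 = 4"
  proof -
    have "(Re \<zeta>)\<^sup>2 + (Im \<zeta>)\<^sup>2 = 1" "(Re \<omega>)\<^sup>2 + (Im \<omega>)\<^sup>2 = 1"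
      using n cmod_power2[of \<zeta>] cmod_power2[of \<omega>] by simp_all
    then show ?thesis unfolding cmod_power2 by (simp add: power2_eq_square algebra_simps)
  qed
  have fac: "cmod (z - w) = cmod (\<zeta> - \<omega>) * cmod (\<zeta> + \<omega>)"
    by (simp add: sq[symmetric] norm_mult[symmetric] power2_eq_square algebra_simps)
  have "cmod (\<zeta> + \<omega>) \<ge> 4/3 \<or> cmod (\<zeta> - \<omega>) \<ge> 4/3"
  proof (rule ccontr)
    assume "\<not> ?thesis"
    then have "(cmod (\<zeta> - \<omega>))\<^sup>2 \<le> (4/3)\<^sup>2" "(cmod (\<zeta> + \<omega>))\<^sup>2 \<le> (4/3)\<^sup>2"
      by (auto intro!: power_mono)
    then show False using \<open>(cmod (\<zeta> - \<omega>))\<^sup>2 + (cmod (\<zeta> + \<omega>))\<^sup>2 = 4\<close>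
      by (simp add: power2_eq_square)
  qed
  then show thesis
  proof
    assume "cmod (\<zeta> + \<omega>) \<ge> 4/3"
    then have "cmod (\<zeta> - \<omega>) * (4/3) \<le> cmod (z - w)"
      unfolding fac by (intro mult_left_mono) auto
    then show thesis using that[of \<zeta> \<omega>] n sq by simp
  next
    assume "cmod (\<zeta> - \<omega>) \<ge> 4/3"
    then have "4/3 * cmod (\<zeta> + \<omega>) \<le> cmod (z - w)"
      unfolding fac by (intro mult_right_mono) auto
    then show thesis using that[of \<zeta> "- \<omega>"] n sq by simp
  qed
qed

text \<open>
  The resolvent of \<open>b\<^sup>2\<close> at \<open>\<zeta>\<^sup>2\<close> is the mean of the resolvents of \<open>b\<close> at \<open>\<zeta>\<close> and \<open>- \<zeta>\<close>. Averaging
  keeps the Lipschitz constant, and taking square roots on the circle, with suitably matched signs,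
  contracts distances by the factor \<open>3/4\<close>.
\<close>

lemma lipschitz_resolvent_square:
  fixes b :: "'a::complex_banach_algebra_1"
  assumes "lipschitz_resolvent L b" "L \<ge> 0"
  shows "lipschitz_resolvent (3/4 * L) (b * b)"
proof -
  define R where "R z = elem_inverse (1 - z *\<^sub>C b)" for z
  have inv: "invertible_elem (1 - z *\<^sub>C b)" if "cmod z = 1" for z
    using assms(1) that by (simp add: lipschitz_resolvent_def)
  have lip: "norm (R z - R w) \<le> L * cmod (z - w)" if "cmod z = 1" "cmod w = 1" for z w
    using assms(1) that by (simp add: lipschitz_resolvent_def R_def)
  have sq: "invertible_elem (1 - \<zeta>\<^sup>2 *\<^sub>C (b * b))"
    "elem_inverse (1 - \<zeta>\<^sup>2 *\<^sub>C (b * b)) = (1/2) *\<^sub>R (R \<zeta> + R (- \<zeta>))" if "cmod \<zeta> = 1" for \<zeta>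
  proof -
    have e: "(\<zeta> *\<^sub>C b) * (\<zeta> *\<^sub>C b) = \<zeta>\<^sup>2 *\<^sub>C (b * b)"
      by (simp add: mult_scaleC_left mult_scaleC_right scaleC_scaleC power2_eq_square)
    have m: "1 + \<zeta> *\<^sub>C b = 1 - (- \<zeta>) *\<^sub>C b" by (simp add: scaleC_minus_left)
    have i: "invertible_elem (1 - \<zeta> *\<^sub>C b)" "invertible_elem (1 + \<zeta> *\<^sub>C b)"
      using inv[of \<zeta>] inv[of "- \<zeta>"] that m by simp_all
    show "invertible_elem (1 - \<zeta>\<^sup>2 *\<^sub>C (b * b))"
      using elem_inverse_product_mean(1)[OF i] e by simp
    show "elem_inverse (1 - \<zeta>\<^sup>2 *\<^sub>C (b * b)) = (1/2) *\<^sub>R (R \<zeta> + R (- \<zeta>))"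
      using elem_inverse_product_mean(3)[OF i] e m by (simp add: R_def)
  qed
  show ?thesis
    unfolding lipschitz_resolvent_def
  proof (intro conjI allI impI)
    fix z assume "cmod z = 1"
    then show "invertible_elem (1 - z *\<^sub>C (b * b))"
      using sq(1)[of "csqrt z"] by (simp add: norm_csqrt)
  next
    fix z w assume "cmod z = 1" "cmod w = 1"
    then obtain \<zeta> \<omega> where n: "cmod \<zeta> = 1" "cmod \<omega> = 1" and r: "\<zeta>\<^sup>2 = z" "\<omega>\<^sup>2 = w"
      and d: "cmod (\<zeta> - \<omega>) \<le> 3/4 * cmod (z - w)"
      by (rule unit_circle_root_distance)
    have "elem_inverse (1 - z *\<^sub>C (b * b)) - elem_inverse (1 - w *\<^sub>C (b * b))
        = (1/2) *\<^sub>R ((R \<zeta> - R \<omega>) + (R (- \<zeta>) - R (- \<omega>)))"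
      using sq(2)[OF n(1)] sq(2)[OF n(2)] r by (simp add: algebra_simps)
    also have "norm \<dots> \<le> 1/2 * (norm (R \<zeta> - R \<omega>) + norm (R (- \<zeta>) - R (- \<omega>)))"
      by (simp add: norm_triangle_ineq)
    also have "\<dots> \<le> L * cmod (\<zeta> - \<omega>)"
      using lip[OF n] lip[of "- \<zeta>" "- \<omega>"] n by (simp add: norm_minus_commute)
    also have "\<dots> \<le> L * (3/4 * cmod (z - w))"
      using d assms(2) by (rule mult_left_mono)
    finally show "norm (elem_inverse (1 - z *\<^sub>C (b * b)) - elem_inverse (1 - w *\<^sub>C (b * b)))
        \<le> 3/4 * L * cmod (z - w)" by simp
  qed
qed

text \<open>
  The Riesz idempotent of the part of the spectrum inside the unit circle. In the scalar case
  \<open>(1 - b ^ n)\<^sup>-\<^sup>1\<close> tends to \<open>1\<close> when \<open>\<bar>b\<bar> < 1\<close> and to \<open>0\<close> when \<open>\<bar>b\<bar> > 1\<close>.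
\<close>

lemma spectral_idempotent:
  fixes b :: "'a::complex_banach_algebra_1"
  assumes "\<And>z. cmod z = 1 \<Longrightarrow> invertible_elem (1 - z *\<^sub>C b)"
  obtains p where "p * p = p" "p \<in> commutant b"
    "\<And>k. invertible_elem (1 - b ^ (2 ^ k))"
    "(\<lambda>k. elem_inverse (1 - b ^ (2 ^ k))) \<longlonglongrightarrow> p"
proof -
  obtain L where L: "L \<ge> 0" "lipschitz_resolvent L b"
    using lipschitz_resolventI assms by blast
  define B where "B k = b ^ (2 ^ k)" for k :: nat
  define u where "u k = elem_inverse (1 - B k)" for k
  define v where "v k = elem_inverse (1 + B k)" for k
  have B_Suc: "B (Suc k) = B k * B k" for k by (simp add: B_def mult_2 power_add)
  have lip: "lipschitz_resolvent ((3/4) ^ k * L) (B k)" for k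
  proof (induction k)
    case 0
    then show ?case using L by (simp add: B_def)
  next
    case (Suc k)
    then show ?case
      using lipschitz_resolvent_square[OF Suc.IH] L(1) by (simp add: B_Suc mult_ac)
  qed
  have m: "1 - (- 1) *\<^sub>C B k = 1 + B k" for k
    by (simp only: scaleC_minus_left scaleC_one) simp
  have inv: "invertible_elem (1 - B k)" "invertible_elem (1 + B k)" for k
  proof -
    have i: "invertible_elem (1 - z *\<^sub>C B k)" if "cmod z = 1" for z
      using lip[of k] that unfolding lipschitz_resolvent_def by blast
    show "invertible_elem (1 - B k)" using i[of 1] by simp
    show "invertible_elem (1 + B k)" using i[of "- 1"] unfolding m by simp
  qed
  have "norm (elem_inverse (1 - 1 *\<^sub>C B k) - elem_inverse (1 - (- 1) *\<^sub>C B k))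
      \<le> (3/4) ^ k * L * cmod (1 - (- 1))" for k
    using lip[of k] unfolding lipschitz_resolvent_def
    by (elim conjE allE[of _ 1] allE[of _ "- 1"] impE) (simp_all only: norm_one norm_minus_cancel)
  then have uv: "norm (u k - v k) \<le> (3/4) ^ k * L * 2" for k
    unfolding m u_def v_def by simp
  have prod: "u (Suc k) = u k * v k" and mean: "u (Suc k) = (1/2) *\<^sub>R (u k + v k)" for k
    using elem_inverse_product_mean[OF inv, of k] by (simp_all add: u_def v_def B_Suc)
  have step: "norm (u (Suc k) - u k) \<le> L * (3/4) ^ k" for k
  proof -
    have "u k = (1/2) *\<^sub>R (u k + u k)" by (simp add: scaleR_2[symmetric])
    then have "u (Suc k) - u k = (1/2) *\<^sub>R (v k - u k)"
      by (metis mean add_diff_cancel_left scaleR_diff_right)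
    then show ?thesis using uv[of k] by (simp add: norm_minus_commute mult_ac)
  qed
  have "summable (\<lambda>k. L * (3/4) ^ k)"
    by (intro summable_mult summable_geometric) simp
  then have "summable (\<lambda>k. u (Suc k) - u k)"
    by (rule summable_comparison_test'[where N = 0]) (rule step)
  then have "(\<lambda>n. \<Sum>k<n. u (Suc k) - u k) \<longlonglongrightarrow> (\<Sum>k. u (Suc k) - u k)"
    by (rule summable_LIMSEQ)
  then have "(\<lambda>n. (u n - u 0) + u 0) \<longlonglongrightarrow> (\<Sum>k. u (Suc k) - u k) + u 0"
    by (intro tendsto_add tendsto_const) (simp only: sum_lessThan_telescope)
  then obtain p where p: "u \<longlonglongrightarrow> p" by auto
  have "(\<lambda>k. (3/4) ^ k * L * 2) \<longlonglongrightarrow> 0"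
    by (intro tendsto_mult_left_zero LIMSEQ_power_zero) simp
  then have "(\<lambda>k. u k - v k) \<longlonglongrightarrow> 0"
    by (rule Lim_null_comparison[OF always_eventually[OF allI[OF uv]]])
  from tendsto_diff[OF p this] have "v \<longlonglongrightarrow> p" by simp
  then have "(\<lambda>k. u (Suc k)) \<longlonglongrightarrow> p * p"
    unfolding prod by (intro tendsto_mult p)
  then have "p * p = p" using LIMSEQ_Suc[OF p] LIMSEQ_unique by blast
  have "u k \<in> commutant b" for k
    unfolding u_def
    by (rule commutant_inverse[OF _ elem_inverse[OF inv(1)]])
       (simp add: B_def commutant_diff commutant_one commutant_power)
  then have "(\<lambda>k. b * u k) = (\<lambda>k. u k * b)" by (simp add: commutant_def)
  moreover have "(\<lambda>k. b * u k) \<longlonglongrightarrow> b * p" "(\<lambda>k. u k * b) \<longlonglongrightarrow> p * b"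
    by (intro tendsto_mult tendsto_const p)+
  ultimately have "p \<in> commutant b" using LIMSEQ_unique by (auto simp: commutant_def)
  show thesis
    using that[OF \<open>p * p = p\<close> \<open>p \<in> commutant b\<close>] inv(1) p by (simp add: B_def u_def[abs_def])
qed

text \<open>
  With \<open>B = b ^ n\<close> and \<open>u = (1 - B)\<^sup>-\<^sup>1\<close> one has \<open>B u = u - 1\<close>. On the corner of \<open>1 - p\<close> this is close to
  \<open>- 1\<close> for large \<open>n\<close>, so \<open>b\<close> is invertible there; on the corner of \<open>p\<close> it is close to \<open>0\<close> with \<open>u\<close>
  close to \<open>1\<close>, so a power of \<open>b p\<close> has norm below one.
\<close>

lemma unit_circle_splitting:
  fixes b :: "'a::complex_banach_algebra_1"
  assumes "\<And>z. cmod z = 1 \<Longrightarrow> invertible_elem (1 - z *\<^sub>C b)"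
  obtains y where "y \<in> commutant b" "y * b * y = y"
    "\<And>z. cmod z \<le> 1 \<Longrightarrow> invertible_elem (1 - z *\<^sub>C (b - b\<^sup>2 * y))"
proof -
  obtain p where pp: "p * p = p" and pb: "p \<in> commutant b"
    and inv: "\<And>k. invertible_elem (1 - b ^ (2 ^ k))"
    and lim: "(\<lambda>k. elem_inverse (1 - b ^ (2 ^ k))) \<longlonglongrightarrow> p"
    using spectral_idempotent[OF assms] by blast
  define U where "U k = elem_inverse (1 - b ^ (2 ^ k))" for k :: nat
  have limU: "U \<longlonglongrightarrow> p" using lim by (simp add: U_def[abs_def])
  have "(\<lambda>k. norm (U k * (1 - p))) \<longlonglongrightarrow> norm (p * (1 - p))"
    by (intro tendsto_intros limU)
  then have "(\<lambda>k. norm (U k * (1 - p))) \<longlonglongrightarrow> 0"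
    using pp by (simp add: right_diff_distrib)
  then have "eventually (\<lambda>k. norm (U k * (1 - p)) < 1) sequentially"
    by (rule order_tendstoD) simp
  moreover have "(\<lambda>k. norm ((U k - 1) * p)) \<longlonglongrightarrow> norm ((p - 1) * p)"
    by (intro tendsto_intros limU)
  then have "(\<lambda>k. norm ((U k - 1) * p)) \<longlonglongrightarrow> 0"
    using pp by (simp add: left_diff_distrib)
  then have "eventually (\<lambda>k. norm ((U k - 1) * p) < 1/3) sequentially"
    by (rule order_tendstoD) simp
  ultimately have "eventually (\<lambda>k. norm (U k * (1 - p)) < 1 \<and> norm ((U k - 1) * p) < 1/3) sequentially"
    by (rule eventually_conj)
  then obtain k where k: "norm (U k * (1 - p)) < 1" "norm ((U k - 1) * p) < 1/3"
    using eventually_happens'[OF sequentially_bot] by blast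
  define u B where "u = U k" and "B = b ^ (2 ^ k)"
  have u_inv: "(1 - B) * u = 1" "u * (1 - B) = 1"
    using elem_inverse[OF inv[of k]] by (simp_all add: u_def U_def B_def)
  have "B * u = u - (1 - B) * u" "u * B = u - u * (1 - B)"
    by (simp_all add: left_diff_distrib right_diff_distrib)
  then have uB: "B * u = u - 1" "u * B = u - 1" unfolding u_inv by simp_all
  have u_comm: "u \<in> commutant b"
    by (rule commutant_inverse[OF _ u_inv])
       (simp add: B_def commutant_diff commutant_one commutant_power)
  have bp: "b * p = p * b" using pb by (simp add: commutant_def)
  have Bp: "B * p = p * B"
    unfolding B_def using bp by (metis power_commuting_commutes)
  have b_pred: "b * b ^ (2 ^ k - 1) = B"
    unfolding B_def by (metis power_Suc Suc_pred' pos2 zero_less_power)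

  \<comment> \<open>The inverse \<open>y\<close> of \<open>b\<close> on the corner of \<open>1 - p\<close>: there \<open>b * (b ^ (2 ^ k - 1) * u) = u - 1\<close>
    equals \<open>- (1 - e)\<close>.\<close>
  define e where "e = u * (1 - p)"
  obtain W where W: "(1 - e) * W = 1" "W * (1 - e) = 1"
    using invertible_elem_one_minus[of e] k(1) by (auto simp: e_def u_def invertible_elem_def)
  have W_comm: "W \<in> commutant b"
    by (rule commutant_inverse[OF _ W])
       (simp add: e_def commutant_diff commutant_mult commutant_one pb u_comm)
  define y where "y = (0 - W) * (b ^ (2 ^ k - 1) * u) * (1 - p)"
  have y_comm: "y \<in> commutant b"
    unfolding y_def
    by (intro commutant_mult commutant_diff commutant_one commutant_power pb u_comm W_comm)
       (simp add: commutant_def)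
  have "b * y = - (W * (b * b ^ (2 ^ k - 1) * u) * (1 - p))"
    using W_comm by (simp add: y_def commutant_def mult.assoc[symmetric])
  also have "b * b ^ (2 ^ k - 1) * u = u - 1"
    unfolding b_pred by (rule uB(1))
  also have "- (W * (u - 1) * (1 - p)) = W * ((1 - p) - e)" by (simp add: e_def algebra_simps)
  also have "(1 - p) - e = (1 - e) * (1 - p)" by (simp add: e_def algebra_simps pp)
  also have "W * \<dots> = 1 - p" using W(2) by (simp add: mult.assoc[symmetric])
  finally have "b * y = 1 - p" .
  have "(1 - p) * (1 - p) = 1 - p" by (simp add: left_diff_distrib right_diff_distrib pp)
  then have "y * (1 - p) = y" by (simp only: y_def mult.assoc)
  then have yby: "y * b * y = y" using \<open>b * y = 1 - p\<close> by (simp add: mult.assoc)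
  have res: "b - b\<^sup>2 * y = b * p"
    using \<open>b * y = 1 - p\<close> by (simp add: power2_eq_square mult.assoc right_diff_distrib)

  \<comment> \<open>The norm of \<open>B * p\<close> is estimated through the small element \<open>g = u * B * p\<close>; the bound \<open>1/3\<close>
    on \<open>norm g\<close> leaves \<open>norm (B * p) \<le> 1/2\<close> after absorption.\<close>
  define g where "g = (u - 1) * p"
  have "g = u * (B * p)" by (simp add: g_def uB(2)[symmetric] mult.assoc)
  have "g * B = g * (B * p)" by (simp add: g_def mult.assoc Bp) (metis mult.assoc pp)
  have "B * p = u * (1 - B) * (B * p)" by (simp add: u_inv)
  also have "\<dots> = u * (B * p) - u * (B * (B * p))"
    by (simp add: left_diff_distrib right_diff_distrib mult.assoc)
  also have "B * (B * p) = B * p * B" by (simp add: Bp[symmetric] mult.assoc)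
  also have "u * (B * p) - u * (B * p * B) = g - g * (B * p)"
    using \<open>g = u * (B * p)\<close> \<open>g * B = g * (B * p)\<close> by (simp add: mult.assoc)
  finally have "B * p = g - g * (B * p)" .
  then have "norm (B * p) \<le> norm g + norm (g * (B * p))"
    using norm_triangle_ineq4[of g "g * (B * p)"] by simp
  also have "norm (g * (B * p)) \<le> norm g * norm (B * p)" by (rule norm_mult_ineq)
  also have "norm g * norm (B * p) \<le> 1/3 * norm (B * p)"
    using k(2) by (intro mult_right_mono) (auto simp: g_def u_def)
  finally have "norm (B * p) < 1"
    using k(2) by (simp add: g_def u_def)
  have pow: "(b * p) ^ Suc m = b ^ Suc m * p" for m
  proof (induction m)
    case (Suc m)
    have "(b * p) ^ Suc (Suc m) = (b * p) * (b ^ Suc m * p)" using Suc.IH by simp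
    also have "\<dots> = b * (p * b ^ Suc m) * p" by (simp add: mult.assoc)
    also have "p * b ^ Suc m = b ^ Suc m * p" using bp by (metis power_commuting_commutes)
    also have "b * (b ^ Suc m * p) * p = b ^ Suc (Suc m) * p" by (simp add: mult.assoc pp)
    finally show ?case .
  qed simp
  have powB: "(b * p) ^ (2 ^ k) = B * p"
    unfolding B_def by (metis pow Suc_pred' pos2 zero_less_power)
  have small: "invertible_elem (1 - z *\<^sub>C (b - b\<^sup>2 * y))" if "cmod z \<le> 1" for z
  proof -
    have "norm ((z *\<^sub>C (b * p)) ^ (2 ^ k)) = cmod z ^ (2 ^ k) * norm (B * p)"
      by (simp add: scaleC_power norm_scaleC powB norm_power)
    also have "\<dots> \<le> 1 * norm (B * p)"
      using that by (intro mult_right_mono power_le_one) auto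
    finally have "invertible_elem (1 - (z *\<^sub>C (b * p)) ^ (2 ^ k))"
      using \<open>norm (B * p) < 1\<close> by (intro invertible_elem_one_minus) simp
    then show ?thesis using invertible_elem_one_minus_of_power res by metis
  qed
  show thesis using that y_comm yby small by blast
qed

lemma circle_splitting:
  fixes a :: "'a::complex_banach_algebra_1"
  assumes "s > 0" and circle: "\<And>\<mu>. cmod \<mu> = s \<Longrightarrow> \<mu> \<notin> spectrum a"
  obtains x where "commuting_outer_inverse a x" "spectrum (a - a\<^sup>2 * x) \<subseteq> ball 0 s"
proof -
  define t where "t = complex_of_real s"
  have t: "t \<noteq> 0" "cmod t = s" using \<open>s > 0\<close> by (simp_all add: t_def)
  define b where "b = inverse t *\<^sub>C a"
  have a: "a = t *\<^sub>C b" using t by (simp add: b_def scaleC_scaleC)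
  have "invertible_elem (1 - z *\<^sub>C b)" if "cmod z = 1" for z
  proof -
    have "z \<noteq> 0" using that by auto
    moreover have "t / z \<notin> spectrum a" using that t by (intro circle) (simp add: norm_divide)
    ultimately show ?thesis
      using notin_spectrum_iff[of "t / z" a] t
      by (simp add: b_def scaleC_scaleC divide_inverse mult.commute)
  qed
  then obtain y where y: "y \<in> commutant b" "y * b * y = y"
    and res: "\<And>z. cmod z \<le> 1 \<Longrightarrow> invertible_elem (1 - z *\<^sub>C (b - b\<^sup>2 * y))"
    using unit_circle_splitting by blast
  define x where "x = inverse t *\<^sub>C y"
  have x: "commuting_outer_inverse a x"
    using y t by unfold_locales
      (simp_all add: a x_def commutant_def mult_scaleC_left mult_scaleC_right scaleC_scaleC)
  have inv_sq: "inverse t * (t * t) = t" using t(1) by simp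
  have c: "a - a\<^sup>2 * x = t *\<^sub>C (b - b\<^sup>2 * y)"
    using t(1) by (simp add: inv_sq a x_def scaleC_power mult_scaleC_left mult_scaleC_right scaleC_scaleC
      scaleC_diff_right power2_eq_square)
  have "spectrum (a - a\<^sup>2 * x) \<subseteq> ball 0 s"
  proof (rule ccontr)
    assume "\<not> ?thesis"
    then obtain \<mu> where \<mu>: "\<mu> \<in> spectrum (a - a\<^sup>2 * x)" "cmod \<mu> \<ge> s" by force
    then have "\<mu> \<noteq> 0" using \<open>s > 0\<close> by auto
    have "cmod (t / \<mu>) \<le> 1" using \<mu> t \<open>\<mu> \<noteq> 0\<close> by (simp add: norm_divide)
    then have "invertible_elem (1 - inverse \<mu> *\<^sub>C (a - a\<^sup>2 * x))"
      using res[of "t / \<mu>"] by (simp add: c scaleC_scaleC divide_inverse mult.commute)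
    then show False using \<mu>(1) notin_spectrum_iff[OF \<open>\<mu> \<noteq> 0\<close>] by blast
  qed
  with x show thesis using that by blast
qed

section \<open>Generalized Drazin invertibility and isolated spectral points\<close>

text \<open>
  The inverse leaves the residual \<open>0\<close>, which is quasinilpotent: its spectrum is \<open>{0}\<close> because
  \<open>0 \<noteq> 1\<close>.
\<close>

lemma invertible_elem_imp_gd_invertible:
  fixes a :: "'a::complex_banach_algebra_1"
  assumes "invertible_elem a"
  shows "a \<in> gd_invertible"
proof -
  obtain x where x: "a * x = 1" "x * a = 1" using assms by (auto simp: invertible_elem_def)
  have "a - a\<^sup>2 * x = 0" using x by (simp add: power2_eq_square mult.assoc)
  moreover have "spectrum (0::'a) = {0}"
  proof -
    have "\<mu> \<in> spectrum (0::'a) \<longleftrightarrow> \<mu> = 0" for \<mu>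
    proof (cases "\<mu> = 0")
      case False
      moreover have "invertible_elem (1::'a)" by (auto simp: invertible_elem_def)
      ultimately show ?thesis using notin_spectrum_iff[OF False, of "0::'a"] by simp
    qed (simp add: spectrum_def invertible_elem_def)
    then show ?thesis by auto
  qed
  ultimately show ?thesis
    using x unfolding gd_invertible_def qnil_def commutant_def by (intro CollectI bexI[of _ x]) auto
qed

text \<open>
  Koliha's characterization. A commuting outer inverse with quasinilpotent residual leaves no spectrum
  in a punctured disc; conversely, splitting along a small circle leaves a residual with spectrum
  contained in \<open>{0}\<close>.
\<close>

lemma gd_invertible_iff_isolated:
  fixes a :: "'a::complex_banach_algebra_1"
  shows "a \<in> gd_invertible \<longleftrightarrow> \<not> 0 islimpt spectrum a"
proof
  assume "a \<in> gd_invertible"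
  then obtain x where x: "commuting_outer_inverse a x" and q: "spectrum (a - a\<^sup>2 * x) = {0}"
    by (auto simp: gd_invertible_def qnil_def commuting_outer_inverse_def)
  obtain \<delta> where "\<delta> > 0" "spectrum a \<inter> ball 0 \<delta> \<subseteq> {0}"
    using commuting_outer_inverse.spectrum_subset_residual[OF x] q by metis
  then show "\<not> 0 islimpt spectrum a"
    by (auto elim!: islimptE[of _ _ "ball 0 \<delta>"])
next
  assume "\<not> 0 islimpt spectrum a"
  then obtain r where r: "r > 0" "\<And>\<mu>. \<lbrakk>\<mu> \<in> spectrum a; \<mu> \<noteq> 0\<rbrakk> \<Longrightarrow> cmod \<mu> \<ge> r"
    by (auto simp: islimpt_approachable not_less)
  have "r/2 > 0" "\<And>\<mu>. cmod \<mu> = r/2 \<Longrightarrow> \<mu> \<notin> spectrum a"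
    using r by force+
  then obtain x where x: "commuting_outer_inverse a x" "spectrum (a - a\<^sup>2 * x) \<subseteq> ball 0 (r/2)"
    using circle_splitting by blast
  have sub: "spectrum (a - a\<^sup>2 * x) \<subseteq> {0}"
  proof
    fix \<mu> assume \<mu>: "\<mu> \<in> spectrum (a - a\<^sup>2 * x)"
    then have "cmod \<mu> < r/2" "\<mu> \<in> insert 0 (spectrum a)"
      using x(2) commuting_outer_inverse.spectrum_residual_subset[OF x(1)] by auto
    then show "\<mu> \<in> {0}" using r by force
  qed
  show "a \<in> gd_invertible"
  proof (cases "0 \<in> spectrum (a - a\<^sup>2 * x)")
    case True
    then have "spectrum (a - a\<^sup>2 * x) = {0}" using sub by blast
    then show ?thesis
      using x(1) by (auto simp: gd_invertible_def qnil_def commuting_outer_inverse_def)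
  next
    case False
    then obtain d where d: "d * (a - a\<^sup>2 * x) = 1" "invertible_elem (a - a\<^sup>2 * x)"
      by (auto simp: spectrum_def invertible_elem_def)
    \<comment> \<open>The spectrum of the residual is required to be exactly \<open>{0}\<close>. An invertible residual
      annihilates \<open>x\<close>, so it equals \<open>a\<close>, and \<open>a\<close> is invertible itself.\<close>
    interpret commuting_outer_inverse a x by (rule x(1))
    have "a * x * x = x" using outer ax_commute by simp
    then have "(a - a\<^sup>2 * x) * x = 0" by (simp add: power2_eq_square left_diff_distrib mult.assoc)
    then have "x = 0" using d(1) by (metis mult.assoc mult_1_left mult_zero_right)
    then show ?thesis using d(2) by (simp add: invertible_elem_imp_gd_invertible)
  qed
qed

lemma gd_spectrum_eq: "gd_spectrum a = {\<mu>. \<mu> islimpt spectrum a}"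
proof -
  have "0 islimpt (\<lambda>z. z - \<mu>) ` S \<longleftrightarrow> \<mu> islimpt S" for \<mu> :: complex and S
    by (simp add: islimpt_approachable dist_norm)
  then show ?thesis
    by (simp add: gd_spectrum_def gd_invertible_iff_isolated spectrum_shift)
qed

section \<open>Spectral characterization of ag-Drazin invertibility\<close>

text \<open>
  A compact annulus free of accumulation points of \<open>S\<close> meets \<open>S\<close> in a finite set, so only finitely
  many radii are excluded.
\<close>

lemma circle_avoiding_set:
  fixes S :: "complex set"
  assumes "\<not> 0 islimpt {\<mu>. \<mu> islimpt S}"
  obtains s where "s > 0" "\<And>\<mu>. cmod \<mu> = s \<Longrightarrow> \<mu> \<notin> S"
    "\<And>\<mu>. \<lbrakk>\<mu> islimpt S; \<mu> \<noteq> 0\<rbrakk> \<Longrightarrow> cmod \<mu> > s"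
proof -
  obtain r where r: "r > 0" "\<And>\<mu>. \<lbrakk>\<mu> islimpt S; \<mu> \<noteq> 0\<rbrakk> \<Longrightarrow> cmod \<mu> \<ge> r"
    using assms by (auto simp: islimpt_approachable[where S = "Collect _"] not_less)
  define K where "K = cball (0::complex) (r/2) - ball 0 (r/3)"
  have "compact K" unfolding K_def by (intro compact_diff) auto
  have "finite (K \<inter> S)"
  proof (rule finite_not_islimpt_in_compact[OF \<open>compact K\<close>])
    fix \<mu> assume "\<mu> \<in> K"
    then have "\<mu> \<noteq> 0" "cmod \<mu> < r" using r(1) by (auto simp: K_def)
    then show "\<not> \<mu> islimpt S" using r(2) by force
  qed
  then have "finite (cmod ` (K \<inter> S))" by simp
  moreover have "infinite {r/3<..<r/2}" using r(1) by (intro infinite_Ioo) simp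
  ultimately obtain s where s: "s \<in> {r/3<..<r/2}" "s \<notin> cmod ` (K \<inter> S)"
    by (meson finite_subset subsetI)
  show thesis
  proof (rule that)
    show "s > 0" using s(1) r(1) by simp
    show "\<mu> \<notin> S" if "cmod \<mu> = s" for \<mu>
      using that s by (auto simp: K_def)
    show "cmod \<mu> > s" if "\<mu> islimpt S" "\<mu> \<noteq> 0" for \<mu>
      using r(2)[OF that] s(1) r(1) by simp
  qed
qed

theorem theorem7:
  fixes a :: "'a::complex_banach_algebra_1"
  shows "a \<in> agd_invertible \<longleftrightarrow> \<not> (0 islimpt gd_spectrum a)"
proof
  assume "a \<in> agd_invertible"
  then obtain x where x: "commuting_outer_inverse a x" and c: "a - a\<^sup>2 * x \<in> acc_elems"
    by (auto simp: agd_invertible_def commuting_outer_inverse_def)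
  have c_acc: "\<not> \<mu> islimpt spectrum (a - a\<^sup>2 * x)" if "\<mu> \<noteq> 0" for \<mu>
    using c that gd_spectrum_eq[of "a - a\<^sup>2 * x"] by (auto simp: acc_elems_def gd_spectrum_def)
  obtain \<delta> where \<delta>: "\<delta> > 0" "spectrum a \<inter> ball 0 \<delta> \<subseteq> spectrum (a - a\<^sup>2 * x)"
    using commuting_outer_inverse.spectrum_subset_residual[OF x] by metis
  have "\<mu> = 0" if "\<mu> \<in> gd_spectrum a" "\<mu> \<in> ball 0 \<delta>" for \<mu>
  proof -
    have "\<mu> islimpt (ball 0 \<delta> \<inter> spectrum a)"
      using that eventually_at_in_open'[of "ball 0 \<delta>" \<mu>]
      by (simp add: gd_spectrum_eq islimpt_Int_eventually Int_commute)
    then have "\<mu> islimpt spectrum (a - a\<^sup>2 * x)"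
      using \<delta>(2) islimpt_subset by (metis Int_commute)
    then show ?thesis using c_acc by blast
  qed
  then show "\<not> 0 islimpt gd_spectrum a"
    using \<delta>(1) by (auto elim!: islimptE[of _ _ "ball 0 \<delta>"])
next
  assume "\<not> 0 islimpt gd_spectrum a"
  then obtain s where s: "s > 0" "\<And>\<mu>. cmod \<mu> = s \<Longrightarrow> \<mu> \<notin> spectrum a"
    "\<And>\<mu>. \<lbrakk>\<mu> islimpt spectrum a; \<mu> \<noteq> 0\<rbrakk> \<Longrightarrow> cmod \<mu> > s"
    unfolding gd_spectrum_eq using circle_avoiding_set by metis
  obtain x where x: "commuting_outer_inverse a x" "spectrum (a - a\<^sup>2 * x) \<subseteq> ball 0 s"
    using circle_splitting[OF s(1,2)] by blast
  have "a - a\<^sup>2 * x - \<mu> *\<^sub>C 1 \<in> gd_invertible" if "\<mu> \<noteq> 0" for \<mu>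
  proof (rule ccontr)
    assume "\<not> ?thesis"
    then have lp: "\<mu> islimpt spectrum (a - a\<^sup>2 * x)"
      using gd_spectrum_eq[of "a - a\<^sup>2 * x"] by (auto simp: gd_spectrum_def)
    then have "\<mu> islimpt insert 0 (spectrum a)"
      using commuting_outer_inverse.spectrum_residual_subset[OF x(1)] islimpt_subset by metis
    then have "\<mu> islimpt spectrum a" by (simp add: islimpt_insert)
    then have "cmod \<mu> > s" using s(3) that by blast
    moreover have "\<mu> islimpt cball 0 s"
      using lp x(2) ball_subset_cball islimpt_subset by (metis order_trans)
    then have "cmod \<mu> \<le> s" using closed_cball closed_limpt by (metis mem_cball_0)
    ultimately show False by simp
  qed
  then show "a \<in> agd_invertible"
    using x(1) by (auto simp: agd_invertible_def acc_elems_def commuting_outer_inverse_def)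
qed

end
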